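(* Let $m\ge 2$ be an integer for which a Hadamard matrix $H_m\in\mathbb{R}^{m\times m}$ exists, let $d=m^2-1$, and let $H_{d+1}=H_m\otimes H_m$ (Kronecker product), a Hadamard matrix of order $d+1$, normalized (by multiplication on the left and right by diagonal matrices with $\pm1$ diagonal entries) so that its first row and first column consist entirely of $1$s. Let $X_d\in\mathbb{R}^{(d+1)\times d}$ be the matrix obtained by removing the first column of $H_{d+1}$, and let $\Lambda_1$ be the Lebesgue constant on the cube $K=[-1,1]^d$ for degree one interpolation at the $d+1$ points given by the rows of $X_d$. Then $$\Lambda_1=\sqrt{d+1}.$$
   Context: A Hadamard matrix of order $n$ is a matrix $H_n\in\mathbb{R}^{n\times n}$ with all entries in $\{+1,-1\}$ and $H_nH_n^t=nI_n$. Denote by $\mathbf{x}_1,\dots,\mathbf{x}_{d+1}$ the rows of $X_d$, regarded as points of $\mathbb{R}^d$ (vertices of the cube). The fundamental Lagrange polynomials $\ell_1,\dots,\ell_{d+1}$ are the unique polynomials of degree at most one on $\mathbb{R}^d$ with $\ell_i(\mathbf{x}_j)=\delta_{ij}$, and the Lebesgue constant is $\Lambda_1:=\max_{\mathbf{x}\in[-1,1]^d}\sum_{i=1}^{d+1}|\ell_i(\mathbf{x})|$. *)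

theory Defs
  imports
    Complex_Main
    "HOL-Library.FuncSet"
    "Jordan_Normal_Form.Matrix"
begin

definition hadamard_matrix :: "nat \<Rightarrow> real mat \<Rightarrow> bool" where
  "hadamard_matrix n H \<longleftrightarrow>
     H \<in> carrier_mat n n \<and> (\<forall>i<n. \<forall>j<n. H $$ (i, j) \<in> {1, -1}) \<and>
     H * transpose_mat H = real n \<cdot>\<^sub>m 1\<^sub>m n"

definition kronecker_product :: "'a::times mat \<Rightarrow> 'a mat \<Rightarrow> 'a mat" (infixl "\<otimes>\<^sub>K" 70) where
  "A \<otimes>\<^sub>K B = mat (dim_row A * dim_row B) (dim_col A * dim_col B)
     (\<lambda>(i, j). A $$ (i div dim_row B, j div dim_col B) * B $$ (i mod dim_row B, j mod dim_col B))"

definition sign_diagonal :: "nat \<Rightarrow> real mat \<Rightarrow> bool" where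
  "sign_diagonal n D \<longleftrightarrow>
     D \<in> carrier_mat n n \<and> diagonal_mat D \<and> (\<forall>i<n. D $$ (i, i) \<in> {1, -1})"

definition remove_first_col :: "'a mat \<Rightarrow> 'a mat" where
  "remove_first_col A = mat (dim_row A) (dim_col A - 1) (\<lambda>(i, j). A $$ (i, Suc j))"

text \<open>Polynomials of degree at most one on \<open>\<real>\<^sup>d\<close>. Since \<open>\<real>\<^sup>d\<close> is only the subset
  \<open>carrier_vec d\<close> of the type of vectors, the polynomial functions are made \<open>undefined\<close>
  outside of it; otherwise they would not be determined by their values on \<open>\<real>\<^sup>d\<close>.\<close>

definition polys_deg_le_1 :: "nat \<Rightarrow> (real vec \<Rightarrow> real) set" where
  "polys_deg_le_1 d =
     {restrict (\<lambda>x. c + (\<Sum>j<d. a j * x $ j)) (carrier_vec d) | c a. True}"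

text \<open>The nodes are the rows of \<open>X\<close>. The description is proper only if exactly one such
  polynomial exists.\<close>

definition fundamental_lagrange :: "real mat \<Rightarrow> nat \<Rightarrow> real vec \<Rightarrow> real" where
  "fundamental_lagrange X i =
     (THE p. p \<in> polys_deg_le_1 (dim_col X) \<and>
        (\<forall>j<dim_row X. p (row X j) = (if i = j then 1 else 0)))"

definition cube :: "nat \<Rightarrow> real vec set" where
  "cube d = {x \<in> carrier_vec d. \<forall>j<d. x $ j \<in> {-1..1}}"

text \<open>A maximum over an infinite set, hence \<^const>\<open>Greatest\<close> and not \<^const>\<open>Max\<close>; it is
  a specified value only if the maximum is attained.\<close>

definition lebesgue_constant :: "real mat \<Rightarrow> real" where
  "lebesgue_constant X =
     (GREATEST v. v \<in> (\<lambda>x. \<Sum>i<dim_row X. \<bar>fundamental_lagrange X i x\<bar>) ` cube (dim_col X))"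

end

theory Submission
  imports Defs "Jordan_Normal_Form.Determinant" "HOL-Analysis.Convex"
begin

text \<open>For a normalized Hadamard matrix \<open>N\<close> of order \<open>n = d + 1\<close> the orthogonality of its rows
  gives \<open>\<ell>\<^sub>i(x) = (N y)\<^sub>i / n\<close> with \<open>y = (1, x)\<close>. If \<open>s\<close> is the sign vector of \<open>N y\<close>, then
  \<open>\<parallel>N y\<parallel>\<^sub>1 = \<langle>N\<^sup>T s, y\<rangle> \<le> \<parallel>N\<^sup>T s\<parallel>\<^sub>1 \<le> \<surd>n \<parallel>N\<^sup>T s\<parallel>\<^sub>2 = n \<surd>n\<close> on the cube, so that
  the Lebesgue constant is at most \<open>\<surd>n\<close>. Equality needs a sign vector \<open>y\<close> with \<open>y\<^sub>0 = 1\<close> and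
  \<open>\<bar>(N y)\<^sub>i\<bar> = \<surd>n\<close> for all \<open>i\<close>. For \<open>H \<otimes> H\<close>, the vector \<open>z\<close> with \<open>z\<^bsub>(k,l)\<^esub> = H\<^bsub>lk\<^esub>\<close> satisfies
  \<open>((H \<otimes> H) z)\<^bsub>(a,b)\<^esub> = m H\<^bsub>ba\<^esub>\<close>, and the normalization is undone by changing signs.\<close>

section \<open>Orthogonality of rows and columns of Hadamard matrices\<close>

lemma hadamard_matrix_iff:
  "hadamard_matrix n H \<longleftrightarrow>
     H \<in> carrier_mat n n \<and> (\<forall>i<n. \<forall>j<n. H $$ (i, j) \<in> {1, -1}) \<and>
     (\<forall>i<n. \<forall>j<n. (\<Sum>k<n. H $$ (i, k) * H $$ (j, k)) = (if i = j then real n else 0))"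
proof (cases "H \<in> carrier_mat n n")
  case True
  then have "H * transpose_mat H = real n \<cdot>\<^sub>m 1\<^sub>m n \<longleftrightarrow>
      (\<forall>i<n. \<forall>j<n. (\<Sum>k<n. H $$ (i, k) * H $$ (j, k)) = (if i = j then real n else 0))"
    by (auto simp: mat_eq_iff scalar_prod_def atLeast0LessThan)
  with True show ?thesis
    by (simp add: hadamard_matrix_def)
qed (simp add: hadamard_matrix_def)

lemma hadamard_matrix_entry_cases:
  assumes "hadamard_matrix n H" "i < n" "j < n"
  shows "H $$ (i, j) = 1 \<or> H $$ (i, j) = -1"
  using assms by (auto simp: hadamard_matrix_def)

text \<open>A right inverse of a square matrix is also a left inverse, so the rows being orthogonal
  makes the columns orthogonal too. This is what later gives uniqueness of the Lagrange
  polynomials.\<close>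

lemma hadamard_matrix_transpose:
  assumes "hadamard_matrix n H"
  shows "hadamard_matrix n (transpose_mat H)"
proof (cases "n = 0")
  case False
  have H: "H \<in> carrier_mat n n" and HHt: "H * transpose_mat H = real n \<cdot>\<^sub>m 1\<^sub>m n"
    using assms by (auto simp: hadamard_matrix_def)
  define B where "B = (1 / real n) \<cdot>\<^sub>m transpose_mat H"
  have B: "B \<in> carrier_mat n n" and Ht: "transpose_mat H = real n \<cdot>\<^sub>m B"
    using H False by (auto simp: B_def mat_eq_iff)
  have "H * B = (1 / real n) \<cdot>\<^sub>m (H * transpose_mat H)"
    using H unfolding B_def by (intro mult_smult_distrib[of _ n n]) auto
  also have "\<dots> = 1\<^sub>m n"
    unfolding HHt using False by (auto simp: mat_eq_iff)
  finally have "B * H = 1\<^sub>m n"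
    by (rule mat_mult_left_right_inverse[OF H B])
  then have "transpose_mat H * H = real n \<cdot>\<^sub>m 1\<^sub>m n"
    unfolding Ht using mult_smult_assoc_mat[OF B H] by simp
  moreover have "transpose_mat H $$ (i, j) \<in> {1, -1}" if "i < n" "j < n" for i j
    using hadamard_matrix_entry_cases[OF assms that(2,1)] H that by simp
  ultimately show ?thesis
    using H by (simp add: hadamard_matrix_def)
qed (use assms in \<open>auto simp: hadamard_matrix_def mat_eq_iff\<close>)

section \<open>Kronecker products\<close>

text \<open>Bijection \<open>k = a * n + b\<close>: a sum over a Kronecker index becomes a double
  sum over its two components.\<close>

lemma sum_div_mod:
  fixes f :: "nat \<Rightarrow> nat \<Rightarrow> 'a::comm_monoid_add"
  shows "(\<Sum>k<m * n. f (k div n) (k mod n)) = (\<Sum>a<m. \<Sum>b<n. f a b)"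
proof (cases "n = 0")
  case False
  have "(\<Sum>k<m * n. f (k div n) (k mod n)) = (\<Sum>(a, b)\<in>{..<m} \<times> {..<n}. f a b)"
  proof (rule sum.reindex_bij_witness[where i = "\<lambda>(a, b). a * n + b" and j = "\<lambda>k. (k div n, k mod n)"])
    fix p assume "p \<in> {..<m} \<times> {..<n}"
    then obtain a b where p: "p = (a, b)" "a < m" "b < n" by auto
    have "a * n + b < (a + 1) * n" using p by simp
    also have "\<dots> \<le> m * n" using p by (intro mult_le_mono1) simp
    finally show "(case p of (a, b) \<Rightarrow> a * n + b) \<in> {..<m * n}" using p by simp
  qed (use False in \<open>auto simp: less_mult_imp_div_less\<close>)
  then show ?thesis by (simp add: sum.cartesian_product)
qed simp

text \<open>The inner product of two rows of the Kronecker product factors into an inner product of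
  rows of \<open>A\<close> and one of rows of \<open>B\<close>.\<close>

lemma hadamard_matrix_kronecker:
  assumes "hadamard_matrix m A" "hadamard_matrix n B"
  shows "hadamard_matrix (m * n) (A \<otimes>\<^sub>K B)"
proof -
  have dims: "dim_row A = m" "dim_col A = m" "dim_row B = n" "dim_col B = n"
    using assms by (auto simp: hadamard_matrix_def)
  have div_mod: "i div n < m" "i mod n < n" if "i < m * n" for i
    using that by (auto simp: less_mult_imp_div_less) (metis mod_less_divisor mult_0_right neq0_conv not_less0)
  have entry: "(A \<otimes>\<^sub>K B) $$ (i, j) = A $$ (i div n, j div n) * B $$ (i mod n, j mod n)"
    if "i < m * n" "j < m * n" for i j
    using that by (simp add: kronecker_product_def dims)
  have "(A \<otimes>\<^sub>K B) $$ (i, j) \<in> {1, -1}" if "i < m * n" "j < m * n" for i j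
    using hadamard_matrix_entry_cases[OF assms(1), of "i div n" "j div n"]
      hadamard_matrix_entry_cases[OF assms(2), of "i mod n" "j mod n"] that
    by (auto simp: entry div_mod)
  moreover have "(\<Sum>k<m * n. (A \<otimes>\<^sub>K B) $$ (i, k) * (A \<otimes>\<^sub>K B) $$ (j, k)) =
      (if i = j then real (m * n) else 0)" if ij: "i < m * n" "j < m * n" for i j
  proof -
    have "(\<Sum>k<m * n. (A \<otimes>\<^sub>K B) $$ (i, k) * (A \<otimes>\<^sub>K B) $$ (j, k)) =
        (\<Sum>k<m * n. (A $$ (i div n, k div n) * A $$ (j div n, k div n)) *
                     (B $$ (i mod n, k mod n) * B $$ (j mod n, k mod n)))"
      using ij by (intro sum.cong) (auto simp: entry)
    also have "\<dots> = (\<Sum>a<m. A $$ (i div n, a) * A $$ (j div n, a)) *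
                    (\<Sum>b<n. B $$ (i mod n, b) * B $$ (j mod n, b))"
      by (subst sum_div_mod) (simp add: sum_product)
    also have "\<dots> = (if i div n = j div n \<and> i mod n = j mod n then real (m * n) else 0)"
      using assms div_mod ij by (simp add: hadamard_matrix_iff)
    also have "i div n = j div n \<and> i mod n = j mod n \<longleftrightarrow> i = j"
      by (metis div_mult_mod_eq)
    finally show ?thesis .
  qed
  ultimately show ?thesis
    by (simp add: hadamard_matrix_iff) (simp add: kronecker_product_def dims)
qed

section \<open>Sign changes of rows and columns\<close>

lemma mult_mat_entry:
  assumes "A \<in> carrier_mat n n" "B \<in> carrier_mat n n" "i < n" "j < n"
  shows "(A * B) $$ (i, j) = (\<Sum>k<n. A $$ (i, k) * B $$ (k, j))"
  using assms by (simp add: scalar_prod_def atLeast0LessThan)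

lemma sign_diagonal_mult_entry:
  assumes "sign_diagonal n D" "sign_diagonal n E" "A \<in> carrier_mat n n" "i < n" "j < n"
  shows "(D * A * E) $$ (i, j) = D $$ (i, i) * A $$ (i, j) * E $$ (j, j)"
proof -
  have D: "D \<in> carrier_mat n n" "\<And>k. k < n \<Longrightarrow> k \<noteq> i \<Longrightarrow> D $$ (i, k) = 0"
    and E: "E \<in> carrier_mat n n" "\<And>k. k < n \<Longrightarrow> k \<noteq> j \<Longrightarrow> E $$ (k, j) = 0"
    using assms by (auto simp: sign_diagonal_def diagonal_mat_def)
  have DA: "(D * A) $$ (i, k) = D $$ (i, i) * A $$ (i, k)" if "k < n" for k
  proof -
    have "(D * A) $$ (i, k) = (\<Sum>l<n. D $$ (i, l) * A $$ (l, k))"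
      using D(1) assms(3,4) that by (intro mult_mat_entry)
    also have "\<dots> = (\<Sum>l<n. if l = i then D $$ (i, i) * A $$ (i, k) else 0)"
      using D by (intro sum.cong) auto
    finally show ?thesis using assms by simp
  qed
  have "(D * A * E) $$ (i, j) = (\<Sum>k<n. (D * A) $$ (i, k) * E $$ (k, j))"
    using D(1) E(1) assms(3-5) by (intro mult_mat_entry) auto
  also have "\<dots> = (\<Sum>k<n. if k = j then D $$ (i, i) * A $$ (i, j) * E $$ (j, j) else 0)"
    using E by (intro sum.cong) (auto simp: DA simp del: index_mult_mat(1))
  finally show ?thesis using assms by simp
qed

lemma sign_diagonal_entry_cases:
  assumes "sign_diagonal n D" "i < n"
  shows "D $$ (i, i) = 1 \<or> D $$ (i, i) = -1"
  using assms by (auto simp: sign_diagonal_def)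

lemma hadamard_matrix_sign_diagonal:
  assumes D: "sign_diagonal n D" and E: "sign_diagonal n E" and A: "hadamard_matrix n A"
  shows "hadamard_matrix n (D * A * E)"
proof -
  have carr: "A \<in> carrier_mat n n" "D * A * E \<in> carrier_mat n n"
    using assms by (auto simp: sign_diagonal_def hadamard_matrix_def)
  note entry = sign_diagonal_mult_entry[OF D E carr(1)]
  have "(D * A * E) $$ (i, j) \<in> {1, -1}" if "i < n" "j < n" for i j
    using sign_diagonal_entry_cases[OF D that(1)] sign_diagonal_entry_cases[OF E that(2)]
      hadamard_matrix_entry_cases[OF A that]
    by (auto simp: entry that simp del: index_mult_mat(1))
  moreover have "(\<Sum>k<n. (D * A * E) $$ (i, k) * (D * A * E) $$ (j, k)) =
      (if i = j then real n else 0)" if ij: "i < n" "j < n" for i j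
  proof -
    \<comment> \<open>The column sign \<open>E $$ (k, k)\<close> occurs twice in each summand and
      squares to 1; the row signs do not depend on \<open>k\<close>.\<close>
    have "(\<Sum>k<n. (D * A * E) $$ (i, k) * (D * A * E) $$ (j, k)) =
        (\<Sum>k<n. D $$ (i, i) * D $$ (j, j) * (A $$ (i, k) * A $$ (j, k)))"
    proof (intro sum.cong refl)
      fix k assume "k \<in> {..<n}"
      then show "(D * A * E) $$ (i, k) * (D * A * E) $$ (j, k) =
          D $$ (i, i) * D $$ (j, j) * (A $$ (i, k) * A $$ (j, k))"
        using sign_diagonal_entry_cases[OF E, of k] ij
        by (auto simp: entry simp del: index_mult_mat(1))
    qed
    also have "\<dots> = D $$ (i, i) * D $$ (j, j) * (if i = j then real n else 0)"
      using A ij by (simp add: hadamard_matrix_iff flip: sum_distrib_left)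
    finally show ?thesis
      using sign_diagonal_entry_cases[OF D ij(1)] by (auto simp del: index_mult_mat(1))
  qed
  ultimately show ?thesis
    using carr(2) by (simp add: hadamard_matrix_iff del: index_mult_mat(1))
qed

section \<open>Lagrange polynomials at Hadamard nodes\<close>

text \<open>Orthogonality of the rows shows that the formula interpolates. Orthogonality of the
  columns shows that nothing else does, so that the definite description denotes it.\<close>

lemma fundamental_lagrange_hadamard:
  assumes N: "hadamard_matrix (Suc d) N" and col: "\<forall>i<Suc d. N $$ (i, 0) = 1"
    and i: "i < Suc d"
  shows "fundamental_lagrange (remove_first_col N) i =
    restrict (\<lambda>x. (1 + (\<Sum>j<d. N $$ (i, Suc j) * x $ j)) / real (Suc d)) (carrier_vec d)"
    (is "_ = ?l")
proof -
  let ?X = "remove_first_col N"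
  have carr: "N \<in> carrier_mat (Suc d) (Suc d)"
    using N by (simp add: hadamard_matrix_def)
  then have dims: "dim_row ?X = Suc d" "dim_col ?X = d"
    by (simp_all add: remove_first_col_def)
  have row: "row ?X j \<in> carrier_vec d" "\<And>k. k < d \<Longrightarrow> row ?X j $ k = N $$ (j, Suc k)"
    if "j < Suc d" for j
    using that carr by (auto simp: remove_first_col_def)
  have rows: "(\<Sum>k<Suc d. N $$ (i, k) * N $$ (j, k)) = (if i = j then real (Suc d) else 0)"
    if "i < Suc d" "j < Suc d" for i j
    using N that unfolding hadamard_matrix_iff by blast
  have cols: "(\<Sum>k<Suc d. N $$ (k, i) * N $$ (k, j)) = (if i = j then real (Suc d) else 0)"
    if "i < Suc d" "j < Suc d" for i j
  proof -
    have "(\<Sum>k<Suc d. transpose_mat N $$ (i, k) * transpose_mat N $$ (j, k)) =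
        (if i = j then real (Suc d) else 0)"
      using hadamard_matrix_transpose[OF N] that unfolding hadamard_matrix_iff by blast
    then show ?thesis using carr that by (simp del: sum.lessThan_Suc)
  qed
  show ?thesis unfolding fundamental_lagrange_def dims
  proof (rule the_equality, intro conjI allI impI)
    have "?l = restrict (\<lambda>x. 1 / real (Suc d) + (\<Sum>j<d. N $$ (i, Suc j) / real (Suc d) * x $ j))
        (carrier_vec d)"
      by (simp add: add_divide_distrib sum_divide_distrib)
    then show "?l \<in> polys_deg_le_1 d"
      unfolding polys_deg_le_1_def mem_Collect_eq
      by (intro exI[of _ "1 / real (Suc d)"] exI[of _ "\<lambda>j. N $$ (i, Suc j) / real (Suc d)"] conjI TrueI)
  next
    fix j assume j: "j < Suc d"
    \<comment> \<open>By \<open>col\<close> the constant 1 is the product of the entries in column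
      0, so the numerator at node \<open>j\<close> is the inner product of the full rows
      \<open>i\<close> and \<open>j\<close>.\<close>
    have "1 + (\<Sum>k<d. N $$ (i, Suc k) * row ?X j $ k) = (\<Sum>k<Suc d. N $$ (i, k) * N $$ (j, k))"
      using col i j by (subst sum.lessThan_Suc_shift) (simp add: row)
    then show "?l (row ?X j) = (if i = j then 1 else 0)"
      using rows[OF i j] row(1)[OF j] by simp
  next
    fix p assume p: "p \<in> polys_deg_le_1 d \<and> (\<forall>j<Suc d. p (row ?X j) = (if i = j then 1 else 0))"
    then obtain c a where p_eq: "p = restrict (\<lambda>x. c + (\<Sum>j<d. a j * x $ j)) (carrier_vec d)"
      by (auto simp: polys_deg_le_1_def)
    \<comment> \<open>The constant term comes first, where it meets the column of ones. The
      interpolation conditions then say that \<open>N\<close> maps \<open>b\<close> to the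
      \<open>i\<close>-th unit vector.\<close>
    define b where "b k = (case k of 0 \<Rightarrow> c | Suc j \<Rightarrow> a j)" for k
    have interp: "(\<Sum>k<Suc d. N $$ (j, k) * b k) = (if i = j then 1 else 0)" if "j < Suc d" for j
    proof -
      have "(\<Sum>k<Suc d. N $$ (j, k) * b k) = p (row ?X j)"
        using that col row[OF that]
        by (subst sum.lessThan_Suc_shift) (simp add: p_eq b_def mult.commute)
      then show ?thesis using p that by simp
    qed
    have b: "b k = N $$ (i, k) / real (Suc d)" if k: "k < Suc d" for k
    proof -
      \<comment> \<open>Apply the transpose of \<open>N\<close> to both sides of that linear system:
        the unit vector becomes row \<open>i\<close> of \<open>N\<close>, and \<open>b\<close> is
        multiplied by \<open>Suc d\<close>.\<close>
      have "N $$ (i, k) = (\<Sum>j<Suc d. if j = i then N $$ (i, k) else 0)"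
        using i by (simp del: sum.lessThan_Suc)
      also have "\<dots> = (\<Sum>j<Suc d. N $$ (j, k) * (\<Sum>l<Suc d. N $$ (j, l) * b l))"
        by (intro sum.cong refl) (auto simp: interp simp del: sum.lessThan_Suc)
      also have "\<dots> = (\<Sum>l<Suc d. (\<Sum>j<Suc d. N $$ (j, k) * N $$ (j, l)) * b l)"
        unfolding sum_distrib_left sum_distrib_right
        by (subst sum.swap) (simp add: mult.assoc)
      also have "\<dots> = (\<Sum>l<Suc d. if k = l then real (Suc d) * b l else 0)"
        by (intro sum.cong refl) (use cols k in \<open>auto simp del: sum.lessThan_Suc\<close>)
      also have "\<dots> = real (Suc d) * b k"
        using k by (simp del: sum.lessThan_Suc)
      finally show ?thesis by (simp add: field_simps)
    qed
    have "c = 1 / real (Suc d)"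
      using b[of 0] col i by (simp add: b_def)
    moreover have "a j = N $$ (i, Suc j) / real (Suc d)" if "j < d" for j
      using b[of "Suc j"] that by (simp add: b_def)
    ultimately show "p = ?l"
      by (auto simp: p_eq add_divide_distrib sum_divide_distrib intro!: restrict_ext)
  qed
qed

section \<open>The upper bound\<close>

lemma hadamard_matrix_l1_bound:
  assumes N: "hadamard_matrix n N" and y: "\<forall>k<n. \<bar>y k\<bar> \<le> 1"
  shows "(\<Sum>i<n. \<bar>\<Sum>k<n. N $$ (i, k) * y k\<bar>) \<le> real n * sqrt (real n)"
proof -
  \<comment> \<open>At a zero sum the sign is taken to be 1, so that every \<open>s i\<close>
    squares to 1.\<close>
  define s where "s i = (if (\<Sum>k<n. N $$ (i, k) * y k) \<ge> 0 then 1 else - 1 :: real)" for i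
  define t where "t k = (\<Sum>i<n. s i * N $$ (i, k))" for k
  have s2: "s i * s i = 1" for i by (simp add: s_def)
  \<comment> \<open>Expand the squared norm of the transpose of \<open>N\<close> applied to
    \<open>s\<close>: row orthogonality leaves \<open>n\<close> diagonal terms, each equal to
    \<open>n\<close>.\<close>
  have "(\<Sum>k<n. (t k)\<^sup>2) = (\<Sum>k<n. \<Sum>i<n. \<Sum>j<n. s i * s j * (N $$ (i, k) * N $$ (j, k)))"
    by (simp add: t_def power2_eq_square sum_product ac_simps)
  also have "\<dots> = (\<Sum>i<n. \<Sum>k<n. \<Sum>j<n. s i * s j * (N $$ (i, k) * N $$ (j, k)))"
    by (rule sum.swap)
  also have "\<dots> = (\<Sum>i<n. \<Sum>j<n. s i * s j * (\<Sum>k<n. N $$ (i, k) * N $$ (j, k)))"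
    unfolding sum_distrib_left by (intro sum.cong refl sum.swap)
  also have "\<dots> = (\<Sum>i<n. \<Sum>j<n. if i = j then real n else 0)"
    using N by (intro sum.cong refl) (auto simp: hadamard_matrix_iff s2)
  also have "\<dots> = real n * real n" by simp
  finally have t2: "(\<Sum>k<n. (t k)\<^sup>2) = real n * real n" .
  have "(\<Sum>i<n. \<bar>\<Sum>k<n. N $$ (i, k) * y k\<bar>) = (\<Sum>i<n. s i * (\<Sum>k<n. N $$ (i, k) * y k))"
    by (intro sum.cong refl) (auto simp: s_def)
  also have "\<dots> = (\<Sum>k<n. t k * y k)"
    unfolding t_def sum_distrib_left sum_distrib_right
    by (subst sum.swap) (simp add: mult.assoc)
  also have "\<dots> \<le> (\<Sum>k<n. \<bar>t k\<bar> * 1)"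
  proof (intro sum_mono)
    fix k assume "k \<in> {..<n}"
    then have "\<bar>t k\<bar> * \<bar>y k\<bar> \<le> \<bar>t k\<bar> * 1"
      using y by (intro mult_left_mono) auto
    then show "t k * y k \<le> \<bar>t k\<bar> * 1"
      using abs_ge_self[of "t k * y k"] by (simp add: abs_mult)
  qed
  also have "\<dots> \<le> real n * sqrt (real n)"
  proof (rule power2_le_imp_le)
    \<comment> \<open>Cauchy-Schwarz against the all-ones vector, whose squared norm is
      \<open>n\<close>.\<close>
    have "(\<Sum>k<n. \<bar>t k\<bar> * 1)\<^sup>2 \<le> (\<Sum>k<n. \<bar>t k\<bar>\<^sup>2) * (\<Sum>k<n. 1\<^sup>2)"
      by (rule Cauchy_Schwarz_ineq_sum)
    also have "\<dots> = (real n * sqrt (real n))\<^sup>2"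
      by (simp add: t2 power_mult_distrib power2_eq_square[of "real n"])
    finally show "(\<Sum>k<n. \<bar>t k\<bar> * 1)\<^sup>2 \<le> (real n * sqrt (real n))\<^sup>2" .
  qed simp
  finally show ?thesis .
qed

section \<open>A point of the cube that attains the bound\<close>

text \<open>The vector is \<open>H\<close> with its columns stacked. The Kronecker square sends it
  to the stacking of \<open>H * H * transpose_mat H\<close>, which is \<open>m\<close> times
  \<open>H\<close>; so it is an eigenvector with eigenvalue \<open>m\<close> and entries of modulus
  1.\<close>

lemma hadamard_kronecker_square_flat:
  assumes H: "hadamard_matrix m H" and i: "i < m * m"
  shows "\<bar>\<Sum>k<m * m. (H \<otimes>\<^sub>K H) $$ (i, k) * H $$ (k mod m, k div m)\<bar> = real m"
proof -
  have dims: "dim_row H = m" "dim_col H = m"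
    using H by (auto simp: hadamard_matrix_def)
  have a: "i div m < m" and b: "i mod m < m"
    using i by (auto simp: less_mult_imp_div_less) (metis mod_less_divisor mult_0 neq0_conv not_less0)
  have "(\<Sum>k<m * m. (H \<otimes>\<^sub>K H) $$ (i, k) * H $$ (k mod m, k div m)) =
      (\<Sum>k<m * m. H $$ (i div m, k div m) * H $$ (i mod m, k mod m) * H $$ (k mod m, k div m))"
    using i by (intro sum.cong) (auto simp: kronecker_product_def dims)
  also have "\<dots> = (\<Sum>l<m. H $$ (i mod m, l) * (\<Sum>k<m. H $$ (i div m, k) * H $$ (l, k)))"
    unfolding sum_distrib_left
    by (subst sum_div_mod, subst sum.swap) (simp add: ac_simps)
  also have "\<dots> = (\<Sum>l<m. if i div m = l then real m * H $$ (i mod m, l) else 0)"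
    using H a by (intro sum.cong refl) (auto simp: hadamard_matrix_iff)
  also have "\<dots> = real m * H $$ (i mod m, i div m)"
    using a by simp
  finally show ?thesis
    using hadamard_matrix_entry_cases[OF H b a] by (auto simp: abs_mult)
qed

lemma hadamard_kronecker_square_flat_signed:
  assumes H: "hadamard_matrix m H" and m: "m > 0"
    and D: "sign_diagonal (m * m) D" and E: "sign_diagonal (m * m) E"
  obtains y where "y 0 = 1" "\<forall>k<m * m. \<bar>y k\<bar> \<le> 1"
    "\<forall>i<m * m. \<bar>\<Sum>k<m * m. (D * (H \<otimes>\<^sub>K H) * E) $$ (i, k) * y k\<bar> = real m"
proof -
  \<comment> \<open>The factor \<open>E $$ (k, k)\<close> cancels the column signs of the normalized
    matrix; the row signs disappear in the absolute value.\<close>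
  define z where "z k = E $$ (k, k) * H $$ (k mod m, k div m)" for k
  have K: "H \<otimes>\<^sub>K H \<in> carrier_mat (m * m) (m * m)"
    using hadamard_matrix_kronecker[OF H H] by (simp add: hadamard_matrix_def)
  have z: "\<bar>z k\<bar> = 1" if "k < m * m" for k
    using sign_diagonal_entry_cases[OF E that] m
      hadamard_matrix_entry_cases[OF H, of "k mod m" "k div m"] less_mult_imp_div_less[OF that]
    by (auto simp: z_def)
  have flat: "\<bar>\<Sum>k<m * m. (D * (H \<otimes>\<^sub>K H) * E) $$ (i, k) * z k\<bar> = real m" if i: "i < m * m" for i
  proof -
    have "(\<Sum>k<m * m. (D * (H \<otimes>\<^sub>K H) * E) $$ (i, k) * z k) =
        (\<Sum>k<m * m. D $$ (i, i) * ((H \<otimes>\<^sub>K H) $$ (i, k) * H $$ (k mod m, k div m)))"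
    proof (intro sum.cong refl)
      fix k assume "k \<in> {..<m * m}"
      then show "(D * (H \<otimes>\<^sub>K H) * E) $$ (i, k) * z k =
          D $$ (i, i) * ((H \<otimes>\<^sub>K H) $$ (i, k) * H $$ (k mod m, k div m))"
        using sign_diagonal_entry_cases[OF E, of k] i
        by (auto simp: sign_diagonal_mult_entry[OF D E K] z_def simp del: index_mult_mat(1))
    qed
    then show ?thesis
      using hadamard_kronecker_square_flat[OF H i] sign_diagonal_entry_cases[OF D i]
      by (auto simp: abs_mult simp del: index_mult_mat(1) simp flip: sum_distrib_left)
  qed
  \<comment> \<open>Multiplying by the sign \<open>z 0\<close> makes the first coordinate 1 and
    keeps all absolute values.\<close>
  define y where "y k = z 0 * z k" for k
  have z0: "\<bar>z 0\<bar> = 1" using z m by simp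
  show thesis
  proof (rule that[of y])
    show "y 0 = 1" using z0 by (auto simp: y_def abs_if split: if_splits)
    show "\<forall>k<m * m. \<bar>y k\<bar> \<le> 1" using z z0 by (simp add: y_def abs_mult)
    have "(\<Sum>k<m * m. (D * (H \<otimes>\<^sub>K H) * E) $$ (i, k) * y k) =
        z 0 * (\<Sum>k<m * m. (D * (H \<otimes>\<^sub>K H) * E) $$ (i, k) * z k)" for i
      unfolding y_def sum_distrib_left by (intro sum.cong refl) (rule mult.left_commute)
    then show "\<forall>i<m * m. \<bar>\<Sum>k<m * m. (D * (H \<otimes>\<^sub>K H) * E) $$ (i, k) * y k\<bar> = real m"
      using flat z0 by (simp add: abs_mult del: index_mult_mat(1))
  qed
qed

theorem proposition3p2:
  fixes m d :: nat and H D E N X :: "real mat"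
  assumes "m \<ge> 2"
    and "hadamard_matrix m H"
    and "d = m\<^sup>2 - 1"
    and "sign_diagonal (d + 1) D" and "sign_diagonal (d + 1) E"
    and "N = D * (H \<otimes>\<^sub>K H) * E"
    and "\<forall>j<d + 1. N $$ (0, j) = 1"
    and "\<forall>i<d + 1. N $$ (i, 0) = 1"
    and "X = remove_first_col N"
  shows "lebesgue_constant X = sqrt (real (d + 1))"
proof -
  have n: "Suc d = m * m"
    using assms(1,3) by (simp add: power2_eq_square)
  have D: "sign_diagonal (m * m) D" and E: "sign_diagonal (m * m) E"
    using assms(4,5) n by simp_all
  have N: "hadamard_matrix (Suc d) N"
    unfolding assms(6) n
    using hadamard_matrix_sign_diagonal[OF D E hadamard_matrix_kronecker[OF assms(2,2)]] .
  have col: "\<forall>i<Suc d. N $$ (i, 0) = 1" using assms(8) by simp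
  have dims: "dim_row X = Suc d" "dim_col X = d"
    using N by (auto simp: assms(9) hadamard_matrix_def remove_first_col_def)
  \<comment> \<open>A point \<open>x\<close> is lifted to \<open>y = (1, x)\<close>, which turns the
    Lebesgue function into the 1-norm of \<open>N\<close> applied to \<open>y\<close>, divided by
    \<open>Suc d\<close>.\<close>
  have lebesgue: "(\<Sum>i<Suc d. \<bar>fundamental_lagrange X i x\<bar>) =
      (\<Sum>i<Suc d. \<bar>\<Sum>k<Suc d. N $$ (i, k) * y k\<bar>) / real (Suc d)"
    if x: "x \<in> carrier_vec d" and y: "y 0 = 1" "\<And>j. j < d \<Longrightarrow> y (Suc j) = x $ j" for x y
  proof -
    have "\<bar>fundamental_lagrange X i x\<bar> = \<bar>\<Sum>k<Suc d. N $$ (i, k) * y k\<bar> / real (Suc d)"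
      if i: "i < Suc d" for i
    proof -
      have "(\<Sum>k<Suc d. N $$ (i, k) * y k) = 1 + (\<Sum>j<d. N $$ (i, Suc j) * x $ j)"
        using col i y by (subst sum.lessThan_Suc_shift) simp
      then show ?thesis
        using fundamental_lagrange_hadamard[OF N col i] x by (simp add: assms(9))
    qed
    then show ?thesis
      unfolding sum_divide_distrib by (intro sum.cong) auto
  qed
  show ?thesis
    unfolding lebesgue_constant_def dims
  proof (rule Greatest_equality)
    obtain y where y: "y 0 = 1" "\<forall>k<m * m. \<bar>y k\<bar> \<le> 1"
      "\<forall>i<m * m. \<bar>\<Sum>k<m * m. (D * (H \<otimes>\<^sub>K H) * E) $$ (i, k) * y k\<bar> = real m"
      using hadamard_kronecker_square_flat_signed[OF assms(2) _ D E] assms(1) by auto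
    \<comment> \<open>Since \<open>y 0 = 1\<close>, dropping this coordinate gives a point whose
      lift is \<open>y\<close> again.\<close>
    define x where "x = vec d (\<lambda>j. y (Suc j))"
    have "\<bar>y (Suc j)\<bar> \<le> 1" if "j < d" for j
      using y(2) n that by (metis Suc_less_eq)
    then have "x \<in> cube d" by (simp add: cube_def x_def abs_le_iff minus_le_iff)
    moreover have "sqrt (real (d + 1)) = (\<Sum>i<Suc d. \<bar>fundamental_lagrange X i x\<bar>)"
    proof -
      have "(\<Sum>i<Suc d. \<bar>fundamental_lagrange X i x\<bar>) =
          (\<Sum>i<Suc d. \<bar>\<Sum>k<Suc d. N $$ (i, k) * y k\<bar>) / real (Suc d)"
        using y(1) by (intro lebesgue) (auto simp: x_def)
      \<comment> \<open>All \<open>m * m\<close> absolute values equal \<open>m\<close>, so their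
        mean is \<open>m\<close>, the square root of \<open>d + 1\<close>.\<close>
      also have "\<dots> = (\<Sum>i<m * m. real m) / real (m * m)"
        using y(3) by (simp only: n assms(6)) simp
      also have "\<dots> = real m" using assms(1) by simp
      also have "\<dots> = sqrt (real (d + 1))"
        using n by (simp add: real_sqrt_mult del: of_nat_Suc)
      finally show ?thesis by simp
    qed
    ultimately show "sqrt (real (d + 1)) \<in> (\<lambda>x. \<Sum>i<Suc d. \<bar>fundamental_lagrange X i x\<bar>) ` cube d"
      by blast
  next
    fix v assume "v \<in> (\<lambda>x. \<Sum>i<Suc d. \<bar>fundamental_lagrange X i x\<bar>) ` cube d"
    then obtain x where x: "x \<in> cube d" and v: "v = (\<Sum>i<Suc d. \<bar>fundamental_lagrange X i x\<bar>)"
      by blast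
    define y where "y k = (case k of 0 \<Rightarrow> 1 | Suc j \<Rightarrow> x $ j)" for k
    have "v = (\<Sum>i<Suc d. \<bar>\<Sum>k<Suc d. N $$ (i, k) * y k\<bar>) / real (Suc d)"
      using x unfolding v by (intro lebesgue) (auto simp: y_def cube_def)
    also have "\<dots> \<le> real (Suc d) * sqrt (real (Suc d)) / real (Suc d)"
    proof (intro divide_right_mono hadamard_matrix_l1_bound[OF N])
      show "\<forall>k<Suc d. \<bar>y k\<bar> \<le> 1"
        using x by (auto simp: y_def cube_def abs_le_iff minus_le_iff split: nat.split)
    qed simp
    finally show "v \<le> sqrt (real (d + 1))" by simp
  qed
qed

end
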